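(* Let $D_3=(V,A)$ be the digraph with vertex set $V=\{v_1,v_2,v_3,v_4,v_5\}$ and arc set $A=\{(v_2,v_1),(v_2,v_3),(v_4,v_1),(v_4,v_3),(v_5,v_2),(v_5,v_3),(v_5,v_4)\}$ (where $v_1,v_2,v_3,v_4,v_5$ represent holomorphic, CR, anti-invariant, slant and semi-slant submanifolds of almost Hermitian manifolds, respectively). Then: (i) $D_3$ is a three-partite digraph; (ii) the maximum size of a matching of $D_3$ is $2$; (iii) the independence number of $D_3$ is $2$; (iv) the chromatic number of $D_3$ is $3$; (v) $D_3$ has a directed spanning tree; (vi) the domination number of $D_3$ is $2$.
   Context: An arc $(u,v)$ goes from $u$ to $v$. The geometric meaning of the vertices plays no role in the statement; the digraph is the explicit one given. Definitions for a digraph $D=(V,A)$: - $D$ is $p$-partite if $V$ can be partitioned into $p$ nonempty sets such that no arc joins two vertices of the same set. - A matching is a set of arcs, none a loop, no two of which share an end-vertex. - A set of vertices is independent if there are no arcs between its members. The independence number is the maximum size of an independent set. The chromatic number is the minimum number of sets in a partition of $V$ into independent sets. - A directed spanning tree of $D$ with root $r\in V$ is a subdigraph $T$ of $D$ with $V(T)=V$ whose underlying undirected graph is a tree and in which there is a unique directed path from $r$ to each $v\in V\setminus\{r\}$. "$D$ has a directed spanning tree" means one exists for some root $r$. - A dominating set is a set $S\subseteq V$ such that for every $v\in V\setminus S$ there is $u\in S$ with $(u,v)\in A$. The domination number is the minimum cardinality of a dominating set. *)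

theory Defs
  imports "Graph_Theory.Digraph_Component" "HOL-Library.Disjoint_Sets"
begin

text \<open>
  The numerical invariants below are meaningful for finite digraphs; the chromatic number
  additionally presupposes that there are no loops.
\<close>

definition independent_set :: "('a, 'b) pre_digraph \<Rightarrow> 'a set \<Rightarrow> bool" where
  "independent_set G S \<longleftrightarrow>
     S \<subseteq> verts G \<and> (\<forall>e\<in>arcs G. \<not> (tail G e \<in> S \<and> head G e \<in> S))"

definition independence_number :: "('a, 'b) pre_digraph \<Rightarrow> nat" where
  "independence_number G = Max {card S | S. independent_set G S}"

definition independent_partition :: "('a, 'b) pre_digraph \<Rightarrow> 'a set set \<Rightarrow> bool" where
  "independent_partition G P \<longleftrightarrow>
     finite P \<and> partition_on (verts G) P \<and> (\<forall>X\<in>P. independent_set G X)"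

definition partite :: "nat \<Rightarrow> ('a, 'b) pre_digraph \<Rightarrow> bool" where
  "partite p G \<longleftrightarrow> (\<exists>P. independent_partition G P \<and> card P = p)"

definition chromatic_number :: "('a, 'b) pre_digraph \<Rightarrow> nat" where
  "chromatic_number G = (LEAST k. \<exists>P. independent_partition G P \<and> card P = k)"

definition matching :: "('a, 'b) pre_digraph \<Rightarrow> 'b set \<Rightarrow> bool" where
  "matching G M \<longleftrightarrow> M \<subseteq> arcs G \<and> (\<forall>e\<in>M. tail G e \<noteq> head G e) \<and>
     (\<forall>e\<in>M. \<forall>f\<in>M. e \<noteq> f \<longrightarrow> {tail G e, head G e} \<inter> {tail G f, head G f} = {})"

definition matching_number :: "('a, 'b) pre_digraph \<Rightarrow> nat" where
  "matching_number G = Max {card M | M. matching G M}"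

text \<open>
  The library predicates \<^const>\<open>forest\<close> and \<^const>\<open>tree\<close> only exclude directed cycles, and
  \<^term>\<open>forest (mk_symmetric G)\<close> fails as soon as \<^term>\<open>G\<close> has an arc (the walk u, v, u counts
  as a cycle). So acyclicity of the underlying undirected graph is expressed on the digraph
  in which every arc may be traversed in both directions, where a cycle must not use the same
  arc twice. The underlying graph is read as a multigraph: loops and pairs of opposite arcs are
  cycles.
\<close>

definition bidirect :: "('a, 'b) pre_digraph \<Rightarrow> ('a, 'b \<times> bool) pre_digraph" where
  "bidirect G = \<lparr> verts = verts G, arcs = arcs G \<times> UNIV,
     tail = (\<lambda>(e, fwd). if fwd then tail G e else head G e),
     head = (\<lambda>(e, fwd). if fwd then head G e else tail G e) \<rparr>"

definition underlying_tree :: "('a, 'b) pre_digraph \<Rightarrow> bool" where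
  "underlying_tree G \<longleftrightarrow>
     connected G \<and> \<not> (\<exists>p. pre_digraph.cycle (bidirect G) p \<and> distinct (map fst p))"

definition directed_spanning_tree ::
    "('a, 'b) pre_digraph \<Rightarrow> 'a \<Rightarrow> ('a, 'b) pre_digraph \<Rightarrow> bool" where
  "directed_spanning_tree T r G \<longleftrightarrow>
     r \<in> verts G \<and> spanning T G \<and> underlying_tree T \<and>
     (\<forall>v\<in>verts G - {r}. \<exists>!p. pre_digraph.apath T r p v)"

definition has_directed_spanning_tree :: "('a, 'b) pre_digraph \<Rightarrow> bool" where
  "has_directed_spanning_tree G \<longleftrightarrow> (\<exists>T r. directed_spanning_tree T r G)"

definition dominating_set :: "('a, 'b) pre_digraph \<Rightarrow> 'a set \<Rightarrow> bool" where
  "dominating_set G S \<longleftrightarrow> S \<subseteq> verts G \<and> (\<forall>v\<in>verts G - S. \<exists>u\<in>S. u \<rightarrow>\<^bsub>G\<^esub> v)"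

definition domination_number :: "('a, 'b) pre_digraph \<Rightarrow> nat" where
  "domination_number G = (LEAST n. \<exists>S. dominating_set G S \<and> finite S \<and> card S = n)"

text \<open>
  V1, ..., V5 stand for holomorphic, CR, anti-invariant, slant and semi-slant submanifolds
  of almost Hermitian manifolds.
\<close>

datatype vertex = V1 | V2 | V3 | V4 | V5

definition D3 :: "(vertex, vertex \<times> vertex) pre_digraph" where
  "D3 = with_proj \<lparr> pverts = {V1, V2, V3, V4, V5},
     parcs = {(V2, V1), (V2, V3), (V4, V1), (V4, V3), (V5, V2), (V5, V3), (V5, V4)} \<rparr>"

end

theory Submission
  imports Defs
begin

section \<open>Trees in which every vertex has at most one incoming arc\<close>

text \<open>
  If no two arcs of a digraph share their head, then a trail of the bidirected digraph that has
  gone forward along an arc can never go backward again: it would have to reuse that arc.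
  So a closed trail is purely forward or purely backward, which a height function increasing
  along arcs excludes.
\<close>

lemma bidirect_simps [simp]:
  "verts (bidirect G) = verts G"
  "arcs (bidirect G) = arcs G \<times> UNIV"
  "tail (bidirect G) (e, b) = (if b then tail G e else head G e)"
  "head (bidirect G) (e, b) = (if b then head G e else tail G e)"
  by (simp_all add: bidirect_def)

lemma trail_stays_forward:
  assumes "inj_on (head G) (arcs G)"
    and "pre_digraph.cas (bidirect G) u ((e, True) # p) v"
    and "set ((e, True) # p) \<subseteq> arcs (bidirect G)"
    and "distinct (map fst ((e, True) # p))"
  shows "\<forall>a\<in>set p. snd a"
  using assms(2-)
proof (induction p arbitrary: e u)
  case Nil
  then show ?case by simp
next
  case (Cons a p)
  obtain f b where a: "a = (f, b)" by fastforce
  have b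
  proof (rule ccontr)
    assume "\<not> b"
    \<comment> \<open>Going forward along \<open>e\<close> ends at its head, and going backward
      along \<open>f\<close> starts at its head. Injectivity then makes \<open>f\<close> equal to
      \<open>e\<close>, a repeated arc.\<close>
    with Cons.prems(1) have "head G f = head G e"
      by (simp add: a pre_digraph.cas.simps)
    with Cons.prems(2,3) assms(1) show False
      by (auto simp: a inj_on_def)
  qed
  with Cons.prems Cons.IH[of "head G e" f] show ?case
    by (simp add: a pre_digraph.cas.simps)
qed

lemma forward_walk_increasing:
  fixes h :: "'a \<Rightarrow> nat"
  assumes "\<And>e. e \<in> arcs G \<Longrightarrow> h (tail G e) < h (head G e)"
    and "pre_digraph.cas (bidirect G) u p v" "set p \<subseteq> arcs (bidirect G)"
    and "\<forall>a\<in>set p. snd a" "p \<noteq> []"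
  shows "h u < h v"
  using assms(2-)
proof (induction p arbitrary: u)
  case (Cons a p)
  obtain e where a: "a = (e, True)" using Cons.prems(3) by (cases a) auto
  have "h u < h (head G e)"
    using Cons.prems assms(1)[of e] by (auto simp: a pre_digraph.cas.simps)
  \<comment> \<open>The induction hypothesis covers only a nonempty tail; for a single arc the
    inequality just shown is already the claim.\<close>
  with Cons show ?case
    by (cases "p = []") (force simp: a pre_digraph.cas.simps)+
qed simp

lemma backward_walk_decreasing:
  fixes h :: "'a \<Rightarrow> nat"
  assumes "\<And>e. e \<in> arcs G \<Longrightarrow> h (tail G e) < h (head G e)"
    and "pre_digraph.cas (bidirect G) u p v" "set p \<subseteq> arcs (bidirect G)"
    and "\<forall>a\<in>set p. \<not> snd a" "p \<noteq> []"
  shows "h v < h u"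
  using assms(2-)
proof (induction p arbitrary: u)
  case (Cons a p)
  obtain e where a: "a = (e, False)" using Cons.prems(3) by (cases a) auto
  have "h (tail G e) < h u"
    using Cons.prems assms(1)[of e] by (auto simp: a pre_digraph.cas.simps)
  with Cons show ?case
    by (cases "p = []") (force simp: a pre_digraph.cas.simps)+
qed simp

lemma no_undirected_cycle:
  fixes h :: "'a \<Rightarrow> nat"
  assumes inj: "inj_on (head G) (arcs G)"
    and h: "\<And>e. e \<in> arcs G \<Longrightarrow> h (tail G e) < h (head G e)"
    and cycle: "pre_digraph.cycle (bidirect G) p" and dist: "distinct (map fst p)"
  shows False
proof -
  obtain u where cas: "pre_digraph.cas (bidirect G) u p u"
    and arcs: "set p \<subseteq> arcs (bidirect G)" and "p \<noteq> []"
    using cycle unfolding pre_digraph.cycle_def pre_digraph.awalk_def by auto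
  \<comment> \<open>Otherwise \<open>p\<close> would run backward throughout and give
    \<open>h u < h u\<close>.\<close>
  have "\<exists>a\<in>set p. snd a"
    using backward_walk_decreasing[OF h cas arcs] \<open>p \<noteq> []\<close> by auto
  then obtain xs e ys where p: "p = xs @ (e, True) # ys"
    by (metis (full_types) prod.collapse split_list)
  obtain w where "pre_digraph.cas (bidirect G) w ((e, True) # ys) u"
    using cas unfolding p pre_digraph.cas_append_iff by blast
  then have "\<forall>a\<in>set ys. snd a"
    using arcs dist by (intro trail_stays_forward[OF inj]) (auto simp: p)
  \<comment> \<open>Everything from \<open>e\<close> on runs forward, whatever the first arc
    does.\<close>
  then have "snd (last p)"
    by (simp add: p)
  then obtain qs f where q: "p = qs @ [(f, True)]"
    using \<open>p \<noteq> []\<close> by (metis (full_types) append_butlast_last_id prod.collapse)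
  have f: "head G f = u"
    using cas unfolding q pre_digraph.cas_append_iff by (simp add: pre_digraph.cas.simps)
  obtain g b rs where r: "p = (g, b) # rs"
    using \<open>p \<noteq> []\<close> by (metis list.exhaust surj_pair)
  \<comment> \<open>It remains to exclude a change of direction at the base point \<open>u\<close>.
    If the first arc runs forward, so does all of \<open>p\<close>, and \<open>h\<close> would
    increase from \<open>u\<close> to \<open>u\<close>. If it runs backward, it leaves
    \<open>u\<close> from its head, while the last arc \<open>f\<close> enters \<open>u\<close> at
    its head. Hence both are the same arc, used in both directions.\<close>
  show False
  proof (cases b)
    case True
    then have "\<forall>a\<in>set p. snd a"
      using trail_stays_forward[OF inj] cas arcs dist by (auto simp: r)
    then show False
      using forward_walk_increasing[OF h cas arcs] \<open>p \<noteq> []\<close> by auto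
  next
    case False
    then have "head G g = u"
      using cas by (simp add: r pre_digraph.cas.simps)
    moreover have "(f, True) \<in> set p" "(g, b) \<in> set p"
      by (simp add: q) (simp add: r)
    ultimately have "g = f"
      using f inj arcs by (auto simp: inj_on_def)
    then have "(f, True) = (g, b)"
      using dist \<open>(f, True) \<in> set p\<close> \<open>(g, b) \<in> set p\<close>
      by (metis distinct_map fst_conv inj_onD)
    with False show False
      by simp
  qed
qed

text \<open>A walk can be traced back from its end: the last arc is the only one with that head. The
  tracing stops exactly at \<open>r\<close>, which no arc enters, so neither walk can be longer than
  the other.\<close>

lemma unique_walk_from_root:
  assumes inj: "inj_on (head G) (arcs G)" and root: "r \<notin> head G ` arcs G"
    and "pre_digraph.awalk G r p v" "pre_digraph.awalk G r q v"
  shows "p = q"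
  using assms(3-)
proof (induction p arbitrary: v q rule: rev_induct)
  case Nil
  then show ?case
    using root by (cases q rule: rev_cases)
      (auto simp: pre_digraph.awalk_def pre_digraph.cas_append_iff pre_digraph.cas.simps)
next
  case (snoc e p)
  then have e: "e \<in> arcs G" "head G e = v" "pre_digraph.awalk G r p (tail G e)"
    by (auto simp: pre_digraph.awalk_def pre_digraph.cas_append_iff pre_digraph.cas.simps)
  show ?case
  proof (cases q rule: rev_cases)
    case Nil
    with snoc.prems(2) e root show ?thesis
      by (auto simp: pre_digraph.awalk_def pre_digraph.cas.simps)
  next
    case (snoc q' f)
    with \<open>pre_digraph.awalk G r q v\<close>
    have f: "f \<in> arcs G" "head G f = v" "pre_digraph.awalk G r q' (tail G f)"
      by (auto simp: pre_digraph.awalk_def pre_digraph.cas_append_iff pre_digraph.cas.simps)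
    with e inj have "f = e" by (auto simp: inj_on_def)
    with f e snoc snoc.IH show ?thesis by auto
  qed
qed

section \<open>Bounds on the invariants\<close>

text \<open>The end-vertices of the arcs in \<open>M\<close> form pairwise disjoint sets, each of
  size two because loops are excluded.\<close>

lemma matching_card_le:
  assumes "wf_digraph G" "finite (verts G)" "finite (arcs G)" "matching G M"
  shows "2 * card M \<le> card (verts G)"
proof -
  interpret wf_digraph G by fact
  have M: "M \<subseteq> arcs G" "finite M"
    using assms finite_subset by (auto simp: matching_def)
  have "card (\<Union>e\<in>M. {tail G e, head G e}) = (\<Sum>e\<in>M. card {tail G e, head G e})"
    using assms(4) M(2) by (intro card_UN_disjoint) (auto simp: matching_def)
  also have "\<dots> = (\<Sum>e\<in>M. 2)"
    using assms(4) by (intro sum.cong) (auto simp: matching_def)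
  finally have "2 * card M = card (\<Union>e\<in>M. {tail G e, head G e})"
    by simp
  also have "\<dots> \<le> card (verts G)"
    using M(1) assms(2) by (intro card_mono) auto
  finally show ?thesis .
qed

text \<open>Two adjacent vertices never lie in one independent class, so choosing for each clique
  vertex a class containing it is injective.\<close>

lemma clique_card_le:
  assumes P: "independent_partition G P" and "K \<subseteq> verts G"
    and clique: "\<And>u v. u \<in> K \<Longrightarrow> v \<in> K \<Longrightarrow> u \<noteq> v \<Longrightarrow>
      \<exists>e\<in>arcs G. {tail G e, head G e} = {u, v}"
  shows "card K \<le> card P"
proof -
  have "\<forall>v\<in>K. \<exists>X\<in>P. v \<in> X"
    using assms by (auto simp: independent_partition_def partition_on_def)
  then obtain c where c: "\<And>v. v \<in> K \<Longrightarrow> c v \<in> P \<and> v \<in> c v"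
    by metis
  have "inj_on c K"
  proof (rule inj_onI, rule ccontr)
    fix u v assume uv: "u \<in> K" "v \<in> K" "c u = c v" "u \<noteq> v"
    then obtain e where "e \<in> arcs G" "{tail G e, head G e} = {u, v}"
      using clique by blast
    moreover have "{u, v} \<subseteq> c u" "independent_set G (c u)"
      using c[of u] c[of v] uv P by (auto simp: independent_partition_def)
    ultimately show False
      by (auto simp: independent_set_def doubleton_eq_iff)
  qed
  then show ?thesis
    using c P by (intro card_inj_on_le[of c]) (auto simp: independent_partition_def)
qed

section \<open>The digraph of submanifold classes\<close>

lemma D3_simps [simp]:
  "verts D3 = {V1, V2, V3, V4, V5}"
  "arcs D3 = {(V2, V1), (V2, V3), (V4, V1), (V4, V3), (V5, V2), (V5, V3), (V5, V4)}"
  "tail D3 = fst"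
  "head D3 = snd"
  "arcs_ends D3 = {(V2, V1), (V2, V3), (V4, V1), (V4, V3), (V5, V2), (V5, V3), (V5, V4)}"
  by (simp_all add: D3_def)

lemma wf_D3: "wf_digraph D3"
  by unfold_locales auto

text \<open>The classes are layers: the sinks, the vertices whose out-neighbours are all sinks, and
  the source \<open>V5\<close>.\<close>

lemma independent_partition_D3: "independent_partition D3 {{V1, V3}, {V2, V4}, {V5}}"
  by (auto simp: independent_partition_def independent_set_def partition_on_def disjoint_def)

lemma partite_D3: "partite 3 D3"
  unfolding partite_def
  by (intro exI[of _ "{{V1, V3}, {V2, V4}, {V5}}"] conjI independent_partition_D3)
    (simp add: doubleton_eq_iff)

lemma matching_number_D3: "matching_number D3 = 2"
  unfolding matching_number_def
proof (rule Max_eqI)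
  have "{M. matching D3 M} \<subseteq> Pow (arcs D3)"
    by (auto simp: matching_def)
  then have "finite {M. matching D3 M}"
    by (rule finite_subset) simp
  then show "finite {card M |M. matching D3 M}"
    by simp
next
  fix n assume "n \<in> {card M |M. matching D3 M}"
  \<comment> \<open>There are five vertices, so \<open>2 * n \<le> 5\<close>.\<close>
  then show "n \<le> 2"
    using matching_card_le[OF wf_D3] by fastforce
next
  have "matching D3 {(V2, V1), (V4, V3)}"
    by (auto simp: matching_def)
  then show "2 \<in> {card M |M. matching D3 M}"
    by (intro CollectI exI[of _ "{(V2, V1), (V4, V3)}"]) simp
qed

text \<open>\<open>V2\<close> and \<open>V4\<close> are each adjacent to all of \<open>V1\<close>,
  \<open>V3\<close> and \<open>V5\<close>, and \<open>V5\<close> is adjacent to \<open>V3\<close>.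
  The three sets are the maximal independent ones.\<close>

lemma independent_set_D3:
  assumes "independent_set D3 S"
  shows "S \<subseteq> {V1, V3} \<or> S \<subseteq> {V1, V5} \<or> S \<subseteq> {V2, V4}"
proof -
  have "V2 \<in> S \<or> V4 \<in> S \<Longrightarrow> S \<subseteq> {V2, V4}"
    and "V5 \<in> S \<Longrightarrow> S \<subseteq> {V1, V5}"
    using assms by (auto simp: independent_set_def)
  moreover have "S \<subseteq> {V1, V2, V3, V4, V5}"
    using assms by (auto simp: independent_set_def)
  ultimately show ?thesis by blast
qed

lemma independence_number_D3: "independence_number D3 = 2"
  unfolding independence_number_def
proof (rule Max_eqI)
  have "{S. independent_set D3 S} \<subseteq> Pow (verts D3)"
    by (auto simp: independent_set_def)
  then have "finite {S. independent_set D3 S}"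
    by (rule finite_subset) simp
  then show "finite {card S |S. independent_set D3 S}"
    by simp
next
  fix n assume "n \<in> {card S |S. independent_set D3 S}"
  then obtain S where "independent_set D3 S" "n = card S"
    by blast
  then obtain a b where "S \<subseteq> {a, b}"
    using independent_set_D3 by blast
  then have "card S \<le> card {a, b}"
    by (intro card_mono) auto
  then show "n \<le> 2"
    using \<open>n = card S\<close> card_2_iff[of "{a, b}"] by (cases "a = b") auto
next
  have "independent_set D3 {V1, V3}"
    by (auto simp: independent_set_def)
  then show "2 \<in> {card S |S. independent_set D3 S}"
    by (intro CollectI exI[of _ "{V1, V3}"]) simp
qed

lemma chromatic_number_D3: "chromatic_number D3 = 3"
  unfolding chromatic_number_def
proof (rule Least_equality)
  show "\<exists>P. independent_partition D3 P \<and> card P = 3"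
    using partite_D3 by (simp add: partite_def)
next
  fix k assume "\<exists>P. independent_partition D3 P \<and> card P = k"
  then obtain P where "independent_partition D3 P" "card P = k"
    by blast
  \<comment> \<open>These three vertices span a triangle.\<close>
  moreover have "card {V2, V3, V5} \<le> card P"
    using \<open>independent_partition D3 P\<close>
    by (rule clique_card_le) (auto simp: doubleton_eq_iff)
  ultimately show "3 \<le> k"
    by simp
qed

text \<open>Arcs of \<open>D3\<close> are dropped until every vertex other than \<open>V5\<close>
  keeps exactly one incoming arc, with everything still reachable from \<open>V5\<close>.\<close>

definition spanning_tree_D3 :: "(vertex, vertex \<times> vertex) pre_digraph" where
  "spanning_tree_D3 = with_proj \<lparr> pverts = {V1, V2, V3, V4, V5},
     parcs = {(V2, V1), (V5, V2), (V5, V3), (V5, V4)} \<rparr>"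

lemma spanning_tree_D3_simps [simp]:
  "verts spanning_tree_D3 = {V1, V2, V3, V4, V5}"
  "arcs spanning_tree_D3 = {(V2, V1), (V5, V2), (V5, V3), (V5, V4)}"
  "tail spanning_tree_D3 = fst"
  "head spanning_tree_D3 = snd"
  by (simp_all add: spanning_tree_D3_def)

lemma spanning_spanning_tree_D3: "spanning spanning_tree_D3 D3"
proof -
  have "wf_digraph spanning_tree_D3"
    by unfold_locales auto
  then show ?thesis
    using wf_D3 by (auto simp: spanning_def subgraph_def compatible_def)
qed

lemma connected_spanning_tree_D3: "connected spanning_tree_D3"
proof -
  let ?H = "with_proj (mk_symmetric spanning_tree_D3)"
  interpret H: wf_digraph ?H
    by unfold_locales (auto simp: mk_symmetric_def)
  have adj: "V5 \<rightarrow>\<^bsub>?H\<^esub> V2" "V2 \<rightarrow>\<^bsub>?H\<^esub> V1" "V5 \<rightarrow>\<^bsub>?H\<^esub> V3" "V5 \<rightarrow>\<^bsub>?H\<^esub> V4"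
    "V2 \<rightarrow>\<^bsub>?H\<^esub> V5" "V1 \<rightarrow>\<^bsub>?H\<^esub> V2" "V3 \<rightarrow>\<^bsub>?H\<^esub> V5" "V4 \<rightarrow>\<^bsub>?H\<^esub> V5"
    by (auto simp: mk_symmetric_def)
  \<comment> \<open>\<open>V5\<close> serves as a hub. Only \<open>V1\<close> is not adjacent to it
    and needs the detour through \<open>V2\<close>.\<close>
  have "v \<rightarrow>\<^sup>*\<^bsub>?H\<^esub> V5 \<and> V5 \<rightarrow>\<^sup>*\<^bsub>?H\<^esub> v" for v
  proof (cases v)
    case V1
    then show ?thesis
      using adj H.reachable_adjI H.adj_reachable_trans by metis
  next
    case V5
    moreover have "V5 \<in> verts ?H"
      by (simp add: mk_symmetric_def)
    ultimately show ?thesis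
      using H.reachable_refl by blast
  qed (use adj in \<open>auto intro: H.reachable_adjI\<close>)
  then have "u \<rightarrow>\<^sup>*\<^bsub>?H\<^esub> v" for u v
    using H.reachable_trans by blast
  moreover have "verts ?H \<noteq> {}"
    by (simp add: mk_symmetric_def)
  ultimately show ?thesis
    unfolding connected_def by (intro strongly_connectedI)
qed

lemma underlying_tree_spanning_tree_D3: "underlying_tree spanning_tree_D3"
proof -
  \<comment> \<open>The height is the depth in the tree below the root \<open>V5\<close>.\<close>
  let ?h = "\<lambda>v. case v of V5 \<Rightarrow> 0::nat | V1 \<Rightarrow> 2 | _ \<Rightarrow> 1"
  have "inj_on (head spanning_tree_D3) (arcs spanning_tree_D3)"
    by (simp add: inj_on_def)
  moreover have "?h (tail spanning_tree_D3 e) < ?h (head spanning_tree_D3 e)"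
    if "e \<in> arcs spanning_tree_D3" for e
    using that by auto
  ultimately have "\<not> (pre_digraph.cycle (bidirect spanning_tree_D3) p \<and> distinct (map fst p))" for p
    using no_undirected_cycle[of spanning_tree_D3 ?h p] by blast
  then show ?thesis
    using connected_spanning_tree_D3 by (simp add: underlying_tree_def)
qed

lemma unique_apath_spanning_tree_D3:
  assumes "v \<in> verts D3 - {V5}"
  shows "\<exists>!p. pre_digraph.apath spanning_tree_D3 V5 p v"
proof (rule ex_ex1I)
  \<comment> \<open>The default branch is an arc of the tree for \<open>V2\<close>,
    \<open>V3\<close> and \<open>V4\<close>; its value at \<open>V5\<close> is meaningless, but
    \<open>v\<close> is not \<open>V5\<close>.\<close>
  let ?p = "case v of V1 \<Rightarrow> [(V5, V2), (V2, V1)] | _ \<Rightarrow> [(V5, v)]"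
  have "pre_digraph.apath spanning_tree_D3 V5 ?p v"
    using assms by (cases v) (simp_all add: pre_digraph.apath_def pre_digraph.awalk_def
        pre_digraph.cas.simps pre_digraph.awalk_verts.simps)
  then show "\<exists>p. pre_digraph.apath spanning_tree_D3 V5 p v" ..
next
  fix p q
  assume "pre_digraph.apath spanning_tree_D3 V5 p v" "pre_digraph.apath spanning_tree_D3 V5 q v"
  then show "p = q"
    unfolding pre_digraph.apath_def
    by (intro unique_walk_from_root[of spanning_tree_D3 V5 p v q]) (auto simp: inj_on_def)
qed

lemma has_directed_spanning_tree_D3: "has_directed_spanning_tree D3"
  unfolding has_directed_spanning_tree_def directed_spanning_tree_def
  by (intro exI[of _ spanning_tree_D3] exI[of _ V5] conjI ballI unique_apath_spanning_tree_D3
      spanning_spanning_tree_D3 underlying_tree_spanning_tree_D3) simp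

lemma domination_number_D3: "domination_number D3 = 2"
  unfolding domination_number_def
proof (rule Least_equality)
  have "dominating_set D3 {V2, V5}"
    by (auto simp: dominating_set_def)
  then show "\<exists>S. dominating_set D3 S \<and> finite S \<and> card S = 2"
    by (intro exI[of _ "{V2, V5}"]) simp
next
  fix n assume "\<exists>S. dominating_set D3 S \<and> finite S \<and> card S = n"
  then obtain S where S: "dominating_set D3 S" "finite S" "card S = n"
    by blast
  \<comment> \<open>\<open>V5\<close> has no in-neighbour, and the in-neighbours of
    \<open>V1\<close> are \<open>V2\<close> and \<open>V4\<close>. Dominating \<open>V1\<close>
    therefore takes a second vertex.\<close>
  then have "V5 \<in> S" "V1 \<in> S \<or> V2 \<in> S \<or> V4 \<in> S"
    by (auto simp: dominating_set_def)
  then obtain u where "u \<noteq> V5" "{u, V5} \<subseteq> S"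
    by blast
  then show "2 \<le> n"
    using card_mono[of S "{u, V5}"] S by simp
qed

theorem theorem3p3:
  shows "partite 3 D3
    \<and> matching_number D3 = 2
    \<and> independence_number D3 = 2
    \<and> chromatic_number D3 = 3
    \<and> has_directed_spanning_tree D3
    \<and> domination_number D3 = 2"
  using partite_D3 matching_number_D3 independence_number_D3 chromatic_number_D3
    has_directed_spanning_tree_D3 domination_number_D3
  by simp

end
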